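(* For any zero-set $\mathcal{Z}$, with $s=s(\mathcal{Z})$, $\mu_{\mathrm{en}}(\mathcal{Z})\le 4s+1$ and $\mu_{\mathrm{th}}(\mathcal{Z})\le 8s+2$. Moreover, $\sup_{\mathcal{Z}\neq\emptyset}\mu_{\mathrm{en}}(\mathcal{Z})/s(\mathcal{Z})\in(0,\infty)$ and $\sup_{\mathcal{Z}\neq\emptyset}\mu_{\mathrm{th}}(\mathcal{Z})/s(\mathcal{Z})\in(0,\infty)$, where the suprema are over all nonempty zero-sets.
   Context: $\mathbb{Z}_+=\{0,1,2,\dots\}$, $\mathbb{N}=\{1,2,\dots\}$. For $a,b\in\mathbb{N}$, $R_{a,b}=([0,a-1]\times[0,b-1])\cap\mathbb{Z}_+^2$, and $R_{0,0}=\emptyset$. A zero-set is a union $\mathcal{Z}=\bigcup_{(a,b)\in\mathcal{I}}R_{a,b}$ over a finite $\mathcal{I}\subseteq\mathbb{N}^2$ (possibly empty). $s(\mathcal{Z})$ is the integer $s\ge0$ with $R_{s,s}\subseteq\mathcal{Z}$ but $R_{s+1,s+1}\not\subseteq\mathcal{Z}$. For $x\in\mathbb{Z}_+^2$, $L^h(x),L^v(x)$ are the horizontal and vertical lines through $x$; for $A\subseteq\mathbb{Z}_+^2$, $\mathtt{row}(x,A)=|L^h(x)\cap A|$, $\mathtt{col}(x,A)=|L^v(x)\cap A|$. Regular dynamics: $\mathcal{T}(A)=A\cup\{x\notin A:(\mathtt{row}(x,A),\mathtt{col}(x,A))\notin\mathcal{Z}\}$; $A$ spans if $\bigcup_t\mathcal{T}^t(A)=\mathbb{Z}_+^2$;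 for finite spanning $A$, $\tau(\mathcal{Z},A)=\min\{t\in\mathbb{N}:\mathcal{T}^t(A)=\mathbb{Z}_+^2\}$. A finite set $A$ is thin if for every $x\in A$, $\mathtt{row}(x,A)=1$ or $\mathtt{col}(x,A)=1$; $\mu_{\mathrm{th}}(\mathcal{Z})=\max\{\tau(\mathcal{Z},A):A\text{ thin and spanning}\}$. Enhanced dynamics: enhancements $\vec r=(r_0,r_1,\dots)$, $\vec c=(c_0,c_1,\dots)$ are weakly decreasing sequences of nonnegative integers; $\mathcal{T}_{\mathrm{en}}(A)=A\cup\{(i,j):(\mathtt{row}((i,j),A)+r_j,\mathtt{col}((i,j),A)+c_i)\notin\mathcal{Z}\}$; $(\vec r,\vec c)$ spans for $\mathcal{Z}$ if $\bigcup_t\mathcal{T}_{\mathrm{en}}^t(\emptyset)=\mathbb{Z}_+^2$; $\tau_{\mathrm{en}}(\mathcal{Z},\vec r,\vec c)=\inf\{t\in\mathbb{N}:\mathcal{T}_{\mathrm{en}}^t(\emptyset)=\mathbb{Z}_+^2\}$; $\mu_{\mathrm{en}}(\mathcal{Z})$ is the maximum of $\tau_{\mathrm{en}}(\mathcal{Z},\vec r,\vec c)$ over spanning pairs with finite support. *)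

theory Defs
  imports "HOL-Library.Extended_Real"
begin

type_synonym site = "nat \<times> nat"

definition rect :: "nat \<Rightarrow> nat \<Rightarrow> site set" where
  "rect a b = {(i, j). i < a \<and> j < b}"

definition zero_set :: "site set \<Rightarrow> bool" where
  "zero_set Z \<longleftrightarrow>
     (\<exists>I. finite I \<and> (\<forall>(a, b)\<in>I. 1 \<le> a \<and> 1 \<le> b) \<and> Z = (\<Union>(a, b)\<in>I. rect a b))"

definition side :: "site set \<Rightarrow> nat" where
  "side Z = (THE s. rect s s \<subseteq> Z \<and> \<not> rect (s + 1) (s + 1) \<subseteq> Z)"

text \<open>Occupied sets may contain infinitely many points of a line, so line counts are extended
  naturals.  A pair of counts lies in the zero-set iff both are finite and their values form an
  element of it.\<close>

definition ecard :: "'a set \<Rightarrow> enat" where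
  "ecard A = (if finite A then enat (card A) else \<infinity>)"

definition in_zero_set :: "enat \<times> enat \<Rightarrow> site set \<Rightarrow> bool" where
  "in_zero_set p Z \<longleftrightarrow> p \<in> map_prod enat enat ` Z"

definition hline :: "site \<Rightarrow> site set" where
  "hline x = {y. snd y = snd x}"

definition vline :: "site \<Rightarrow> site set" where
  "vline x = {y. fst y = fst x}"

definition row :: "site \<Rightarrow> site set \<Rightarrow> enat" where
  "row x A = ecard (hline x \<inter> A)"

definition col :: "site \<Rightarrow> site set \<Rightarrow> enat" where
  "col x A = ecard (vline x \<inter> A)"


subsection \<open>Regular dynamics\<close>

definition step :: "site set \<Rightarrow> site set \<Rightarrow> site set" where
  "step Z A = A \<union> {x. x \<notin> A \<and> \<not> in_zero_set (row x A, col x A) Z}"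

definition spans :: "site set \<Rightarrow> site set \<Rightarrow> bool" where
  "spans Z A \<longleftrightarrow> (\<Union>t. (step Z ^^ t) A) = UNIV"

definition span_time :: "site set \<Rightarrow> site set \<Rightarrow> enat" where
  "span_time Z A = Inf (enat ` {t. 1 \<le> t \<and> (step Z ^^ t) A = UNIV})"

definition thin :: "site set \<Rightarrow> bool" where
  "thin A \<longleftrightarrow> finite A \<and> (\<forall>x\<in>A. row x A = 1 \<or> col x A = 1)"

text \<open>The maximum is taken as a supremum in the complete lattice of extended naturals.  The
  family is never empty (see below), so the supremum is attained as soon as it is finite;
  boundedness is therefore part of any inequality between this number and a natural number.\<close>

definition mu_th :: "site set \<Rightarrow> enat" where
  "mu_th Z = (SUP A\<in>{A. thin A \<and> spans Z A}. span_time Z A)"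


subsection \<open>Enhanced dynamics\<close>

definition step_en :: "site set \<Rightarrow> (nat \<Rightarrow> nat) \<Rightarrow> (nat \<Rightarrow> nat) \<Rightarrow> site set \<Rightarrow> site set" where
  "step_en Z r c A =
     A \<union> {(i, j). \<not> in_zero_set (row (i, j) A + enat (r j), col (i, j) A + enat (c i)) Z}"

definition spans_en :: "site set \<Rightarrow> (nat \<Rightarrow> nat) \<Rightarrow> (nat \<Rightarrow> nat) \<Rightarrow> bool" where
  "spans_en Z r c \<longleftrightarrow> (\<Union>t. (step_en Z r c ^^ t) {}) = UNIV"

definition span_time_en :: "site set \<Rightarrow> (nat \<Rightarrow> nat) \<Rightarrow> (nat \<Rightarrow> nat) \<Rightarrow> enat" where
  "span_time_en Z r c = Inf (enat ` {t. 1 \<le> t \<and> (step_en Z r c ^^ t) {} = UNIV})"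

definition enhancement :: "(nat \<Rightarrow> nat) \<Rightarrow> bool" where
  "enhancement r \<longleftrightarrow> decseq r"

definition fin_supp :: "(nat \<Rightarrow> nat) \<Rightarrow> bool" where
  "fin_supp r \<longleftrightarrow> finite {k. r k \<noteq> 0}"

definition admissible :: "site set \<Rightarrow> (nat \<Rightarrow> nat) \<Rightarrow> (nat \<Rightarrow> nat) \<Rightarrow> bool" where
  "admissible Z r c \<longleftrightarrow>
     enhancement r \<and> enhancement c \<and> fin_supp r \<and> fin_supp c \<and> spans_en Z r c"

definition mu_en :: "site set \<Rightarrow> enat" where
  "mu_en Z = (SUP (r, c)\<in>{(r, c). admissible Z r c}. span_time_en Z r c)"


subsection \<open>Well-definedness\<close>

lemma zero_set_bounded:
  assumes "zero_set Z"
  obtains M where "\<And>a b. (a, b) \<in> Z \<Longrightarrow> a < M \<and> b < M"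
proof -
  from assms obtain I where I: "finite I" "Z = (\<Union>(a, b)\<in>I. rect a b)"
    unfolding zero_set_def by blast
  have "finite Z"
    unfolding I(2)
  proof (rule finite_UN_I[OF I(1)])
    fix p assume "p \<in> I"
    have "rect a b = {..<a} \<times> {..<b}" for a b by (auto simp: rect_def)
    then show "finite (case p of (a, b) \<Rightarrow> rect a b)" by (auto split: prod.split)
  qed
  then have "finite (fst ` Z \<union> snd ` Z)" by simp
  then obtain M where M: "\<forall>k\<in>fst ` Z \<union> snd ` Z. k < M"
    by (meson finite_nat_set_iff_bounded)
  show thesis by (rule that[of M]) (use M in force)
qed

lemma side_unique:
  assumes "zero_set Z"
  shows "\<exists>!s. rect s s \<subseteq> Z \<and> \<not> rect (s + 1) (s + 1) \<subseteq> Z"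
proof -
  obtain M where M: "\<And>a b. (a, b) \<in> Z \<Longrightarrow> a < M \<and> b < M"
    using zero_set_bounded[OF assms] by blast
  have mono: "rect a a \<subseteq> rect b b" if "a \<le> b" for a b
    using that by (auto simp: rect_def)
  have bound: "s \<le> M" if "rect s s \<subseteq> Z" for s
  proof (rule ccontr)
    assume "\<not> s \<le> M"
    then have "(M, M) \<in> rect s s" by (auto simp: rect_def)
    with that M show False by blast
  qed
  let ?S = "{s. rect s s \<subseteq> Z}"
  have fin: "finite ?S" using bound by (auto simp: finite_nat_set_iff_bounded_le)
  have "0 \<in> ?S" by (auto simp: rect_def)
  then have max: "Max ?S \<in> ?S" using Max_in[OF fin] by blast
  have "\<not> rect (Max ?S + 1) (Max ?S + 1) \<subseteq> Z"
    using Max_ge[OF fin, of "Max ?S + 1"] by auto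
  moreover have "s = t"
    if "rect s s \<subseteq> Z" "\<not> rect (s + 1) (s + 1) \<subseteq> Z"
      "rect t t \<subseteq> Z" "\<not> rect (t + 1) (t + 1) \<subseteq> Z" for s t
    using that mono[of "s + 1" t] mono[of "t + 1" s] by (cases s t rule: linorder_cases) auto
  ultimately show ?thesis using max by blast
qed

lemma in_zero_set_bounded:
  assumes "\<And>a b. (a, b) \<in> Z \<Longrightarrow> a < M \<and> b < M" and "in_zero_set (u, v) Z"
  shows "u < enat M" "v < enat M"
  using assms by (auto simp: in_zero_set_def)

lemma ecard_ge:
  assumes "B \<subseteq> A" "finite B" "card B = n"
  shows "enat n \<le> ecard A"
  using assms card_mono[of A B] by (auto simp: ecard_def)

lemma col_ge:
  assumes "\<And>i j. j < M \<Longrightarrow> (i, j) \<in> A"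
  shows "enat M \<le> col x A"
proof -
  have "Pair (fst x) ` {..<M} \<subseteq> vline x \<inter> A" using assms by (auto simp: vline_def)
  moreover have "card (Pair (fst x) ` {..<M}) = M" by (simp add: card_image inj_on_def)
  ultimately show ?thesis unfolding col_def by (intro ecard_ge) auto
qed

lemma ex_admissible:
  assumes "zero_set Z"
  shows "\<exists>r c. admissible Z r c"
proof -
  obtain M where M: "\<And>a b. (a, b) \<in> Z \<Longrightarrow> a < M \<and> b < M"
    using zero_set_bounded[OF assms] by blast
  define r where "r = (\<lambda>j. if j < M then M else 0)"
  let ?c = "\<lambda>_::nat. 0::nat"
  have r: "enhancement r" "fin_supp r"
    by (auto simp: enhancement_def fin_supp_def r_def decseq_def)
  have c: "enhancement ?c" "fin_supp ?c"
    by (auto simp: enhancement_def fin_supp_def decseq_def)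
  have 1: "(i, j) \<in> step_en Z r ?c {}" if "j < M" for i j
    using that in_zero_set_bounded(1)[OF M]
    by (fastforce simp: step_en_def r_def row_def ecard_def)
  have "x \<in> step_en Z r ?c (step_en Z r ?c {})" for x
  proof -
    have "\<not> col x (step_en Z r ?c {}) < enat M"
      using col_ge[OF 1] by (simp add: not_less)
    then show ?thesis
      using in_zero_set_bounded(2)[OF M] unfolding step_en_def[of _ _ _ "step_en Z r ?c {}"]
      by (cases x) (auto simp: zero_enat_def[symmetric])
  qed
  then have "(step_en Z r ?c ^^ 2) {} = UNIV" by (auto simp: numeral_2_eq_2)
  then have "spans_en Z r ?c" unfolding spans_en_def by blast
  with r c show ?thesis unfolding admissible_def by blast
qed

lemma ex_thin_spans:
  assumes "zero_set Z"
  shows "\<exists>A. thin A \<and> spans Z A"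
proof -
  obtain M where M: "\<And>a b. (a, b) \<in> Z \<Longrightarrow> a < M \<and> b < M"
    using zero_set_bounded[OF assms] by blast
  define A :: "site set" where "A = (\<lambda>(k, j). (j * M + k, j)) ` ({..<M} \<times> {..<M})"
  have A_iff: "(i, j) \<in> A \<longleftrightarrow> j < M \<and> (\<exists>k<M. i = j * M + k)" for i j
    by (auto simp: A_def image_iff)
  have "thin A"
    unfolding thin_def
  proof (intro conjI ballI)
    show "finite A" by (simp add: A_def)
    fix x assume x: "x \<in> A"
    have row_div: "snd y = fst y div M" if "y \<in> A" for y
      using that by (auto simp: A_def)
    have "y = x" if "y \<in> vline x \<inter> A" for y
      using that row_div[of x] row_div[of y] x by (auto simp: vline_def prod_eq_iff)
    moreover have "x \<in> vline x \<inter> A" using x by (simp add: vline_def)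
    ultimately have "vline x \<inter> A = {x}" by blast
    then show "row x A = 1 \<or> col x A = 1" by (simp add: col_def ecard_def one_enat_def)
  qed
  have 1: "(i, j) \<in> step Z A" if "j < M" for i j
  proof -
    have "(\<lambda>k. (j * M + k, j)) ` {..<M} \<subseteq> hline (i, j) \<inter> A"
      using that by (auto simp: hline_def A_iff)
    moreover have "card ((\<lambda>k. (j * M + k, j)) ` {..<M}) = M"
      by (simp add: card_image inj_on_def)
    ultimately have "enat M \<le> row (i, j) A" unfolding row_def by (intro ecard_ge) auto
    then have "\<not> in_zero_set (row (i, j) A, col (i, j) A) Z"
      using in_zero_set_bounded(1)[OF M] by (meson not_less)
    then show ?thesis by (auto simp: step_def)
  qed
  have "x \<in> step Z (step Z A)" for x
  proof -
    have "\<not> in_zero_set (row x (step Z A), col x (step Z A)) Z"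
      using in_zero_set_bounded(2)[OF M] col_ge[OF 1] by (meson not_less)
    then show ?thesis unfolding step_def[of _ "step Z A"] by blast
  qed
  then have "(step Z ^^ 2) A = UNIV" by (auto simp: numeral_2_eq_2)
  then have "spans Z A" unfolding spans_def by blast
  with \<open>thin A\<close> show ?thesis by blast
qed

lemma enat_Sup_attained:
  fixes S :: "enat set"
  assumes "S \<noteq> {}" "Sup S \<noteq> \<infinity>"
  shows "Sup S \<in> S"
  using assms Max_in[of S] by (auto simp: Sup_enat_def split: if_splits)

lemma mu_th_attained:
  assumes "zero_set Z" "mu_th Z \<noteq> \<infinity>"
  shows "\<exists>A. thin A \<and> spans Z A \<and> span_time Z A = mu_th Z"
  using enat_Sup_attained[of "span_time Z ` {A. thin A \<and> spans Z A}"] ex_thin_spans[OF assms(1)]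
    assms(2) unfolding mu_th_def by auto

lemma mu_en_attained:
  assumes "zero_set Z" "mu_en Z \<noteq> \<infinity>"
  shows "\<exists>r c. admissible Z r c \<and> span_time_en Z r c = mu_en Z"
proof -
  let ?S = "(\<lambda>(r, c). span_time_en Z r c) ` {(r, c). admissible Z r c}"
  have "?S \<noteq> {}" using ex_admissible[OF assms(1)] by auto
  moreover have "mu_en Z = Sup ?S" by (simp add: mu_en_def)
  ultimately have "mu_en Z \<in> ?S" using enat_Sup_attained[of ?S] assms(2) by simp
  then obtain r c where "admissible Z r c" "mu_en Z = span_time_en Z r c" by auto
  then show ?thesis by metis
qed

end

theory Submission
  imports Defs
begin

text \<open>Both dynamics reduce to a growth of Young diagrams in which the effective count of a
  line is a function of the number of its occupied sites.  Each such function is monotone, at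
  least the identity and 1-Lipschitz, and decreases with the index of the line.  For thin sets
  this holds after the columns have been sorted by row count minus column count of their
  points and the rows in the opposite order, so that the initial set A runs along an
  antidiagonal; then the set occupied at time t is A together with a Young diagram.

  If such a process spans, then every outer corner of the current diagram is added in the next
  step: otherwise its counts would never change.  Hence (i, j) is occupied by time i + j + 1,
  and the square of side s by time 2s - 1.  From then on the first s rows and columns have counts
  at least s, and they are full after at most 2s further steps.  The next step then fills the
  plane.\<close>

subsection \<open>Line counts and staircase sets\<close>

definition staircase :: "site set \<Rightarrow> bool" where
  "staircase Y \<longleftrightarrow> (\<forall>i j i' j'. (i, j) \<in> Y \<longrightarrow> i' \<le> i \<longrightarrow> j' \<le> j \<longrightarrow> (i', j') \<in> Y)"

lemma staircaseD: "staircase Y \<Longrightarrow> (i, j) \<in> Y \<Longrightarrow> i' \<le> i \<Longrightarrow> j' \<le> j \<Longrightarrow> (i', j') \<in> Y"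
  unfolding staircase_def by blast

lemma ecard_image: "inj_on h A \<Longrightarrow> ecard (h ` A) = ecard A"
  by (simp add: ecard_def card_image finite_image_iff)

lemma ecard_mono: "A \<subseteq> B \<Longrightarrow> ecard A \<le> ecard B"
  by (auto simp: ecard_def intro: card_mono dest: finite_subset)

lemma row_eq: "row (k, j) Y = ecard {i. (i, j) \<in> Y}"
proof -
  have "hline (k, j) \<inter> Y = (\<lambda>i. (i, j)) ` {i. (i, j) \<in> Y}"
    by (auto simp: hline_def)
  then show ?thesis unfolding row_def by (simp add: ecard_image inj_on_def)
qed

lemma col_eq: "col (i, k) Y = ecard {j. (i, j) \<in> Y}"
proof -
  have "vline (i, k) \<inter> Y = Pair i ` {j. (i, j) \<in> Y}"
    by (auto simp: vline_def)
  then show ?thesis unfolding col_def by (simp add: ecard_image inj_on_def)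
qed

lemma row_swap: "row (i, j) (prod.swap ` Y) = col (j, i) Y"
  and col_swap: "col (i, j) (prod.swap ` Y) = row (j, i) Y"
  by (simp_all add: row_eq col_eq)

text \<open>A downward closed set of naturals is an initial segment or all of \<open>nat\<close>, so
  its size decides membership.\<close>

lemma mem_iff_ecard:
  assumes "\<And>i i'. i \<in> S \<Longrightarrow> i' \<le> i \<Longrightarrow> i' \<in> S"
  shows "i \<in> S \<longleftrightarrow> enat i < ecard S"
proof (cases "finite S")
  case True
  have "S = {..<card S}"
  proof (cases "S = {}")
    case False
    with True assms have "S = {..Max S}"
      by (auto intro: Max_ge Max_in)
    then show ?thesis by (metis card_atMost lessThan_Suc_atMost)
  qed simp
  then have "i \<in> S \<longleftrightarrow> i < card S" by blast
  with True show ?thesis by (simp add: ecard_def)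
next
  case False
  then obtain k where "k \<in> S" "i \<le> k"
    by (meson infinite_nat_iff_unbounded_le)
  with assms False show ?thesis by (auto simp: ecard_def)
qed

lemma mem_iff_row: "staircase Y \<Longrightarrow> (i, j) \<in> Y \<longleftrightarrow> enat i < row (k, j) Y"
  using mem_iff_ecard[of "{i. (i, j) \<in> Y}" i] by (auto simp: row_eq dest: staircaseD)

lemma mem_iff_col: "staircase Y \<Longrightarrow> (i, j) \<in> Y \<longleftrightarrow> enat j < col (i, k) Y"
  using mem_iff_ecard[of "{j. (i, j) \<in> Y}" j] by (auto simp: col_eq dest: staircaseD)

lemma row_ge:
  assumes "\<And>i'. i' < n \<Longrightarrow> (i', j) \<in> Y"
  shows "enat n \<le> row (i, j) Y"
  unfolding row_eq by (rule ecard_ge[of "{..<n}"]) (use assms in auto)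

lemma col_ge':
  assumes "\<And>j'. j' < n \<Longrightarrow> (i, j') \<in> Y"
  shows "enat n \<le> col (i, j) Y"
  unfolding col_eq by (rule ecard_ge[of "{..<n}"]) (use assms in auto)


subsection \<open>Growth of staircases\<close>

text \<open>\<open>Q u v\<close> stands for counts outside the zero-set; \<open>f j m\<close> and
  \<open>g i m\<close> are the effective counts of row \<open>j\<close> and column \<open>i\<close>
  when the diagram has \<open>m\<close> sites there. Of the zero-set only upward closure of the
  complement and the point \<open>(s, s)\<close> are kept.\<close>

locale staircase_growth =
  fixes Q :: "enat \<Rightarrow> enat \<Rightarrow> bool" and f g :: "nat \<Rightarrow> enat \<Rightarrow> enat" and s :: nat
  assumes Q_mono: "Q u v \<Longrightarrow> u \<le> u' \<Longrightarrow> v \<le> v' \<Longrightarrow> Q u' v'"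
    and Q_side: "Q (enat s) (enat s)"
    and f_mono: "j \<le> j' \<Longrightarrow> m' \<le> m \<Longrightarrow> f j' m' \<le> f j m"
    and g_mono: "j \<le> j' \<Longrightarrow> m' \<le> m \<Longrightarrow> g j' m' \<le> g j m"
    and f_ge: "m \<le> f j m"
    and g_ge: "m \<le> g j m"
    and f_Suc: "f j (enat (Suc n)) \<le> f j (enat n) + 1"
    and g_Suc: "g j (enat (Suc n)) \<le> g j (enat n) + 1"
begin

fun Y :: "nat \<Rightarrow> site set" where
  "Y 0 = {}"
| "Y (Suc t) = Y t \<union> {(i, j). Q (f j (row (i, j) (Y t))) (g i (col (i, j) (Y t)))}"

lemma Y_mono: "t \<le> t' \<Longrightarrow> Y t \<subseteq> Y t'"
  by (rule lift_Suc_mono_le) auto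

text \<open>Moving towards the origin enlarges both line counts and lowers both indices; either
  change can only raise the effective counts.\<close>

lemma staircase_Y: "staircase (Y t)"
proof (induction t)
  case 0
  then show ?case by (simp add: staircase_def)
next
  case (Suc t)
  show ?case
    unfolding staircase_def
  proof (intro allI impI)
    fix i j i' j'
    assume ij: "(i, j) \<in> Y (Suc t)" and le: "i' \<le> i" "j' \<le> j"
    show "(i', j') \<in> Y (Suc t)"
    proof (cases "(i, j) \<in> Y t")
      case True
      with Suc le show ?thesis by (auto dest: staircaseD)
    next
      case False
      with ij have Q: "Q (f j (row (i, j) (Y t))) (g i (col (i, j) (Y t)))" by simp
      have "row (i, j) (Y t) \<le> row (i', j') (Y t)" "col (i, j) (Y t) \<le> col (i', j') (Y t)"
        using Suc le by (auto simp: row_eq col_eq dest: staircaseD intro!: ecard_mono)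
      with Q le show ?thesis by (auto intro: Q_mono f_mono g_mono)
    qed
  qed
qed

lemma funpow_eq_Y:
  assumes "\<And>B i j. (i, j) \<in> F B \<longleftrightarrow>
    (i, j) \<in> B \<or> Q (f j (row (i, j) B)) (g i (col (i, j) B))"
  shows "(F ^^ t) {} = Y t"
  using assms by (induction t) auto

lemma Y_SucI:
  assumes "Q u v" "u \<le> f j (row (i, j) (Y t))" "v \<le> g i (col (i, j) (Y t))"
  shows "(i, j) \<in> Y (Suc t)"
  using assms Q_mono by auto

end

text \<open>At the moment when (i, j) becomes occupied, its row contains at most i and its column at
  most j sites.  In a spanning process these maximal counts therefore suffice for every site.\<close>

locale spanning_staircase_growth = staircase_growth +
  assumes spans: "(\<Union>t. Y t) = UNIV"
begin

lemma Q_corner: "Q (f j (enat i)) (g i (enat j))"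
proof -
  obtain T where "(i, j) \<in> Y T" using spans by blast
  then obtain t where t: "(i, j) \<notin> Y t" "(i, j) \<in> Y (Suc t)"
    by (induction T) auto
  have "row (i, j) (Y t) \<le> enat i" "col (i, j) (Y t) \<le> enat j"
    using t mem_iff_row[OF staircase_Y, of i j t i] mem_iff_col[OF staircase_Y, of i j t j]
    by auto
  with t show ?thesis by (auto intro: Q_mono f_mono g_mono)
qed

text \<open>By induction, at time \<open>i + j\<close> the \<open>i\<close> sites before
  \<open>(i, j)\<close> in its row and the \<open>j\<close> sites before it in its column are
  occupied, which suffices by \<open>Q_corner\<close>.\<close>

lemma mem_Y_add: "(i, j) \<in> Y (Suc (i + j))"
proof (induction "i + j" arbitrary: i j rule: less_induct)
  case less
  have "enat i \<le> row (i, j) (Y (i + j))"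
  proof (rule row_ge)
    fix i' assume "i' < i"
    then show "(i', j) \<in> Y (i + j)"
      using less[of i' j] Y_mono[of "Suc (i' + j)" "i + j"] by auto
  qed
  moreover have "enat j \<le> col (i, j) (Y (i + j))"
  proof (rule col_ge')
    fix j' assume "j' < j"
    then show "(i, j') \<in> Y (i + j)"
      using less[of i j'] Y_mono[of "Suc (i + j')" "i + j"] by auto
  qed
  ultimately show ?case
    by (intro Y_SucI[OF Q_corner[of j i]] f_mono g_mono) auto
qed

text \<open>Once the square of side s is occupied, row j grows through the columns i in the order of
  their counts: at the first unoccupied column of row j the count is already small enough to
  be matched by that of column i.\<close>

lemma mem_Y_row:
  assumes "j < s" "enat (s + 2 * j) \<le> g i (enat j) + enat n"
  shows "(i, j) \<in> Y (2 * s + n)"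
  using assms
proof (induction n arbitrary: i j)
  case 0
  \<comment> \<open>The Lipschitz bound turns \<open>s + 2 * j <= g i j\<close> into
    \<open>s <= g i 0\<close>: column \<open>i\<close> counts \<open>s\<close> even while
    empty.\<close>
  have "g i (enat k) \<le> g i 0 + enat k" for k
  proof (induction k)
    case (Suc k)
    have "g i (enat (Suc k)) \<le> g i (enat k) + 1" by (rule g_Suc)
    also have "\<dots> \<le> g i 0 + enat k + 1" using Suc by (intro add_right_mono)
    finally show ?case by (simp add: add.assoc one_enat_def)
  qed (simp flip: zero_enat_def)
  from this[of j] 0 have "enat s \<le> g i 0"
    by (cases "g i 0"; cases "g i (enat j)") (auto simp: zero_enat_def)
  also have "\<dots> \<le> g i (col (i, j) (Y (2 * s - 1)))" by (intro g_mono) auto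
  finally have g: "enat s \<le> g i (col (i, j) (Y (2 * s - 1)))" .
  have "enat s \<le> row (i, j) (Y (2 * s - 1))"
  proof (rule row_ge)
    fix i' assume "i' < s"
    with 0(1) have "Suc (i' + j) \<le> 2 * s - 1" by linarith
    then show "(i', j) \<in> Y (2 * s - 1)" using mem_Y_add Y_mono by blast
  qed
  also have "\<dots> \<le> f j (row (i, j) (Y (2 * s - 1)))" by (rule f_ge)
  finally have "(i, j) \<in> Y (Suc (2 * s - 1))" by (rule Y_SucI[OF Q_side _ g])
  with 0(1) show ?case by simp
next
  case (Suc n)
  show ?case
  proof (cases "(i, j) \<in> Y (2 * s + n)")
    case True
    then show ?thesis using Y_mono[of "2 * s + n" "2 * s + Suc n"] by auto
  next
    case False
    define k where "k = (LEAST k. (k, j) \<notin> Y (2 * s + n))"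
    have k: "(k, j) \<notin> Y (2 * s + n)" "k \<le> i"
      unfolding k_def using False by (rule LeastI, rule Least_le)
    have below: "(i', j) \<in> Y (2 * s + n)" if "i' < k" for i'
      using that not_less_Least[of i' "\<lambda>k. (k, j) \<notin> Y (2 * s + n)"] unfolding k_def by simp
    \<comment> \<open>The induction hypothesis must fail at \<open>k\<close>, so
      \<open>g k j + n < s + 2 * j <= g i j + n + 1\<close>.\<close>
    have "g k (enat j) + enat n < enat (s + 2 * j)"
      using Suc.IH[OF Suc.prems(1), of k] k(1) by (meson not_le)
    with Suc.prems(2) have gk: "g k (enat j) \<le> g i (enat j)"
      by (cases "g k (enat j)"; cases "g i (enat j)") auto
    have "(i, j') \<in> Y (2 * s + n)" if less: "j' < j" for j'
    proof -
      obtain l where l: "j = Suc l" using less by (cases j) auto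
      \<comment> \<open>Going from \<open>j\<close> to \<open>j - 1\<close> loses at most one in
        \<open>g\<close> and one unit of time; the factor 2 in \<open>s + 2 * j\<close> pays for
        both.\<close>
      have "enat (s + 2 * l) \<le> g i (enat l) + enat n"
        using Suc.prems(2) g_Suc[of i l] l
        by (cases "g i (enat l)"; cases "g i (enat j)") (auto simp: one_enat_def)
      then have "(i, l) \<in> Y (2 * s + n)" using Suc.prems(1) l by (intro Suc.IH) auto
      then show ?thesis
        by (rule staircaseD[OF staircase_Y _ order_refl]) (use less l in simp)
    qed
    then have "enat j \<le> col (i, j) (Y (2 * s + n))" by (rule col_ge')
    then have "g k (enat j) \<le> g i (col (i, j) (Y (2 * s + n)))"
      using gk g_mono[OF order_refl] order_trans by blast
    moreover have "f j (enat k) \<le> f j (row (i, j) (Y (2 * s + n)))"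
      by (intro f_mono row_ge below order_refl)
    \<comment> \<open>The corner condition is taken at \<open>(k, j)\<close>: row \<open>j\<close>
      already holds \<open>k\<close> sites, and column \<open>i\<close> matches column
      \<open>k\<close>.\<close>
    ultimately show ?thesis using Y_SucI[OF Q_corner] by simp
  qed
qed

text \<open>Since \<open>g i j >= j\<close> and \<open>j < s\<close>, the waiting time
  \<open>n = 2 * s\<close> in \<open>mem_Y_row\<close> serves all columns at once.\<close>

lemma rows_full:
  assumes "j < s"
  shows "(i, j) \<in> Y (4 * s)"
proof -
  have "enat (s + 2 * j) \<le> enat j + enat (2 * s)" using assms by simp
  also have "\<dots> \<le> g i (enat j) + enat (2 * s)" by (intro add_right_mono g_ge)
  finally have "(i, j) \<in> Y (2 * s + 2 * s)" by (rule mem_Y_row[OF assms])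
  then show ?thesis by simp
qed

end

section \<open>Symmetry between rows and columns\<close>

context staircase_growth
begin

lemma swap: "staircase_growth (\<lambda>u v. Q v u) g f s"
  by unfold_locales (auto intro: Q_mono Q_side f_mono g_mono f_ge g_ge f_Suc g_Suc)

lemma Y_swap: "staircase_growth.Y (\<lambda>u v. Q v u) g f t = prod.swap ` Y t"
proof (induction t)
  case (Suc t)
  show ?case
    unfolding staircase_growth.Y.simps[OF swap] Suc row_swap col_swap by auto
qed (simp add: staircase_growth.Y.simps[OF swap])

end

text \<open>The transposed process also spans, so \<open>rows_full\<close> yields full columns too;
  every line then meets \<open>s\<close> full perpendicular lines.\<close>

theorem (in spanning_staircase_growth) Y_eq_UNIV: "Y (4 * s + 1) = UNIV"
proof -
  interpret S: staircase_growth "\<lambda>u v. Q v u" g f s by (rule swap)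
  have "(\<Union>t. S.Y t) = prod.swap ` (\<Union>t. Y t)"
    by (simp only: Y_swap image_UN)
  also have "\<dots> = UNIV" unfolding spans by (rule surj_swap)
  finally interpret S: spanning_staircase_growth "\<lambda>u v. Q v u" g f s by unfold_locales
  have cols_full: "(i, j) \<in> Y (4 * s)" if "i < s" for i j
    using S.rows_full[OF that, of j] unfolding Y_swap by auto
  have "(i, j) \<in> Y (Suc (4 * s))" for i j
  proof (rule Y_SucI[OF Q_side])
    show "enat s \<le> f j (row (i, j) (Y (4 * s)))"
      by (rule order_trans[OF row_ge f_ge]) (rule cols_full)
    show "enat s \<le> g i (col (i, j) (Y (4 * s)))"
      by (rule order_trans[OF col_ge' g_ge]) (rule rows_full)
  qed
  then show ?thesis by auto
qed


subsection \<open>Zero-sets\<close>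

lemma zero_set_downward:
  assumes "zero_set Z" "(a, b) \<in> Z" "a' \<le> a" "b' \<le> b"
  shows "(a', b') \<in> Z"
proof -
  obtain I where I: "Z = (\<Union>(a, b)\<in>I. rect a b)"
    using assms(1) unfolding zero_set_def by blast
  show ?thesis using assms(2-4) unfolding I by (fastforce simp: rect_def)
qed

lemma in_zero_set_downward:
  assumes "zero_set Z" "in_zero_set (u', v') Z" "u \<le> u'" "v \<le> v'"
  shows "in_zero_set (u, v) Z"
proof -
  obtain a' b' where ab': "(a', b') \<in> Z" "u' = enat a'" "v' = enat b'"
    using assms(2) by (auto simp: in_zero_set_def)
  then obtain a b where "u = enat a" "v = enat b" "a \<le> a'" "b \<le> b'"
    using assms(3,4) by (cases u; cases v) auto
  then show ?thesis
    using zero_set_downward[OF assms(1) ab'(1)] by (force simp: in_zero_set_def)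
qed

text \<open>Downward closure would otherwise put the whole square of side \<open>side Z + 1\<close>
  into \<open>Z\<close>. This supplies \<open>Q_side\<close>.\<close>

lemma side_not_in_zero_set:
  assumes "zero_set Z"
  shows "\<not> in_zero_set (enat (side Z), enat (side Z)) Z"
proof
  assume "in_zero_set (enat (side Z), enat (side Z)) Z"
  then have "(side Z, side Z) \<in> Z" by (auto simp: in_zero_set_def)
  then have "rect (side Z + 1) (side Z + 1) \<subseteq> Z"
    using zero_set_downward[OF assms] by (auto simp: rect_def)
  then show False using theI'[OF side_unique[OF assms]] unfolding side_def by blast
qed

lemma side_pos:
  assumes "zero_set Z" "Z \<noteq> {}"
  shows "side Z > 0"
proof (rule ccontr)
  assume "\<not> side Z > 0"
  then have "(0, 0) \<notin> Z"
    using side_not_in_zero_set[OF assms(1)] by (force simp: in_zero_set_def)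
  then show False using assms(2) zero_set_downward[OF assms(1)] by auto
qed


subsection \<open>Enhanced dynamics\<close>

text \<open>Adding the constant \<open>r j\<close> or \<open>c i\<close> is a 1-Lipschitz effective
  count, and weakly decreasing enhancements make it decrease with the index of the line.\<close>

lemma span_time_en_le:
  assumes Z: "zero_set Z" and adm: "admissible Z r c"
  shows "span_time_en Z r c \<le> enat (4 * side Z + 1)"
proof -
  define Q where "Q = (\<lambda>u v. \<not> in_zero_set (u, v) Z)"
  define f where "f = (\<lambda>j m. m + enat (r j))"
  define g where "g = (\<lambda>i m. m + enat (c i))"
  have "decseq r" "decseq c" using adm by (auto simp: admissible_def enhancement_def)
  then interpret staircase_growth Q f g "side Z"
    using in_zero_set_downward[OF Z] side_not_in_zero_set[OF Z]
    by unfold_locales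
      (auto simp: Q_def f_def g_def decseq_def one_enat_def intro!: add_mono)
  have Y: "(step_en Z r c ^^ t) {} = Y t" for t
    by (rule funpow_eq_Y) (simp add: step_en_def Q_def f_def g_def)
  interpret spanning_staircase_growth Q f g "side Z"
    using adm by unfold_locales (simp add: admissible_def spans_en_def Y)
  show ?thesis
    unfolding span_time_en_def by (rule Inf_lower) (auto simp only: Y Y_eq_UNIV)
qed


subsection \<open>Sorted initial sets\<close>

text \<open>The size of the union of \<open>S\<close> with an initial segment of size
  \<open>m\<close>: members of \<open>S\<close> below \<open>m\<close> already lie in the
  segment.\<close>

definition union_count :: "nat set \<Rightarrow> enat \<Rightarrow> enat" where
  "union_count S m = m + enat (card {i \<in> S. m \<le> enat i})"

lemma ecard_union_initial:
  assumes "finite S" and P: "\<And>i i'. i \<in> P \<Longrightarrow> i' \<le> i \<Longrightarrow> i' \<in> P"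
  shows "ecard (S \<union> P) = union_count S (ecard P)"
proof (cases "finite P")
  case True
  have mem: "i \<in> P \<longleftrightarrow> enat i < ecard P" for i by (rule mem_iff_ecard[OF P])
  have "S \<union> P = P \<union> {i \<in> S. ecard P \<le> enat i}" "P \<inter> {i \<in> S. ecard P \<le> enat i} = {}"
    by (auto simp: mem)
  then have "card (S \<union> P) = card P + card {i \<in> S. ecard P \<le> enat i}"
    using True assms(1) by (simp add: card_Un_disjoint)
  with True assms(1) show ?thesis by (simp add: ecard_def union_count_def)
next
  case False
  then show ?thesis by (simp add: ecard_def union_count_def)
qed

text \<open>The two summands vary in opposite directions; reading the value as the size of a union
  makes monotonicity evident.\<close>

lemma union_count_mono:
  assumes "finite S" "m' \<le> m"
  shows "union_count S m' \<le> union_count S m"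
proof (cases m)
  case (enat k)
  with assms(2) obtain k' where k': "m' = enat k'" "k' \<le> k" by (cases m') auto
  have "union_count S (enat l) = ecard (S \<union> {..<l})" for l
    using ecard_union_initial[OF assms(1), of "{..<l}"] by (simp add: ecard_def)
  moreover have "S \<union> {..<k'} \<subseteq> S \<union> {..<k}" using k' by auto
  ultimately show ?thesis unfolding enat k' by (simp add: ecard_mono)
qed (simp add: union_count_def)

lemma union_count_Suc:
  assumes "finite S"
  shows "union_count S (enat (Suc n)) \<le> union_count S (enat n) + 1"
proof -
  have "card {i \<in> S. Suc n \<le> i} \<le> card {i \<in> S. n \<le> i}"
    using assms by (intro card_mono) auto
  then show ?thesis by (simp add: union_count_def one_enat_def)
qed

text \<open>The hypotheses \<open>rows\<close> and \<open>cols\<close> concern every tail because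
  \<open>union_count\<close> adds only the sites of \<open>A\<close> beyond the diagram; they make
  the effective counts decrease with the index.\<close>

lemma span_time_sorted_le:
  assumes Z: "zero_set Z" and fin: "finite A" and sp: "spans Z A"
    and rows: "\<And>j j' m. j \<le> j' \<Longrightarrow>
      card {i. (i, j') \<in> A \<and> m \<le> enat i} \<le> card {i. (i, j) \<in> A \<and> m \<le> enat i}"
    and cols: "\<And>i i' m. i \<le> i' \<Longrightarrow>
      card {j. (i', j) \<in> A \<and> m \<le> enat j} \<le> card {j. (i, j) \<in> A \<and> m \<le> enat j}"
  shows "span_time Z A \<le> enat (4 * side Z + 1)"
proof -
  define Q where "Q = (\<lambda>u v. \<not> in_zero_set (u, v) Z)"
  define f where "f = (\<lambda>j. union_count {i. (i, j) \<in> A})"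
  define g where "g = (\<lambda>i. union_count {j. (i, j) \<in> A})"
  have fin_row: "finite {i. (i, j) \<in> A}" for j
    by (rule finite_subset[OF _ finite_imageI[OF fin, of fst]]) force
  have fin_col: "finite {j. (i, j) \<in> A}" for i
    by (rule finite_subset[OF _ finite_imageI[OF fin, of snd]]) force
  have f_mono: "f j' m' \<le> f j m" if "j \<le> j'" "m' \<le> m" for j j' m' m
  proof -
    have "f j' m' \<le> f j m'"
      using rows[OF that(1), of m'] by (simp add: f_def union_count_def add_left_mono)
    also have "\<dots> \<le> f j m"
      unfolding f_def by (rule union_count_mono[OF fin_row that(2)])
    finally show ?thesis .
  qed
  have g_mono: "g i' m' \<le> g i m" if "i \<le> i'" "m' \<le> m" for i i' m' m
  proof -
    have "g i' m' \<le> g i m'"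
      using cols[OF that(1), of m'] by (simp add: g_def union_count_def add_left_mono)
    also have "\<dots> \<le> g i m"
      unfolding g_def by (rule union_count_mono[OF fin_col that(2)])
    finally show ?thesis .
  qed
  interpret staircase_growth Q f g "side Z"
  proof
    show "Q u' v'" if "Q u v" "u \<le> u'" "v \<le> v'" for u v u' v'
      using that in_zero_set_downward[OF Z] by (auto simp: Q_def)
    show "Q (enat (side Z)) (enat (side Z))"
      using side_not_in_zero_set[OF Z] by (simp add: Q_def)
    show "f j (enat (Suc n)) \<le> f j (enat n) + 1" for j n
      unfolding f_def by (rule union_count_Suc[OF fin_row])
    show "g j (enat (Suc n)) \<le> g j (enat n) + 1" for j n
      unfolding g_def by (rule union_count_Suc[OF fin_col])
  qed (use f_mono g_mono in \<open>auto simp: f_def g_def union_count_def\<close>)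
  have row: "row (i, j) (A \<union> B) = f j (row (i, j) B)" if "staircase B" for i j B
    using ecard_union_initial[OF fin_row[of j], of "{i. (i, j) \<in> B}"] that
    by (auto simp: f_def row_eq Un_def dest: staircaseD)
  have col: "col (i, j) (A \<union> B) = g i (col (i, j) B)" if "staircase B" for i j B
    using ecard_union_initial[OF fin_col[of i], of "{j. (i, j) \<in> B}"] that
    by (auto simp: g_def col_eq Un_def dest: staircaseD)
  have Q: "Q u v \<longleftrightarrow> \<not> in_zero_set (u, v) Z" for u v by (simp add: Q_def)
  \<comment> \<open>\<open>Y\<close> may acquire sites of \<open>A\<close>, which
    \<open>step\<close> does not add again; the union with \<open>A\<close> absorbs the
    difference.\<close>
  have step: "step Z (A \<union> Y t) = A \<union> Y (Suc t)" for t
    unfolding step_def Y.simps Q row[OF staircase_Y, symmetric] col[OF staircase_Y, symmetric]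
    by auto
  have Y: "(step Z ^^ t) A = A \<union> Y t" for t
    by (induction t) (simp_all add: step del: Y.simps(2))
  have "(\<Union>t. Y t) = UNIV"
  proof -
    \<comment> \<open>Sites of \<open>A\<close> must enter \<open>Y\<close> as well: a site of the
      same row beyond all columns of \<open>A\<close> does, and the staircase property yields
      everything before it.\<close>
    obtain N where N: "\<forall>n \<in> fst ` A. n < N"
      using fin finite_nat_set_iff_bounded by blast
    have "(i, j) \<in> (\<Union>t. Y t)" for i j
    proof -
      have "(max i N, j) \<notin> A" using N by force
      moreover obtain t where "(max i N, j) \<in> A \<union> Y t"
        using sp unfolding spans_def Y by blast
      ultimately have "(i, j) \<in> Y t" by (auto intro: staircaseD[OF staircase_Y])
      then show ?thesis by blast
    qed
    then show ?thesis by auto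
  qed
  then interpret spanning_staircase_growth Q f g "side Z" by unfold_locales
  have "(step Z ^^ (4 * side Z + 1)) A = UNIV" unfolding Y Y_eq_UNIV by simp
  then show ?thesis unfolding span_time_def by (intro Inf_lower) auto
qed


subsection \<open>Permutations of lines\<close>

text \<open>The dynamics sees a site only through its two line counts, which permutations of columns
  and of rows preserve. With preimages, \<open>h\<close> and \<open>k\<close> send new indices to
  old ones.\<close>

lemma funpow_step_vimage:
  assumes "bij h" "bij k"
  shows "(step Z ^^ t) (map_prod h k -` A) = map_prod h k -` (step Z ^^ t) A"
proof -
  have card: "ecard {i. h' i \<in> S} = ecard S" if "bij h'" for h' :: "nat \<Rightarrow> nat" and S
    using ecard_image[OF inj_on_subset[OF bij_is_inj[OF that] subset_UNIV], of "h' -` S"]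
      surj_image_vimage_eq[OF bij_is_surj[OF that], of S]
    by (simp add: vimage_def)
  have row: "row x (map_prod h k -` B) = row (map_prod h k x) B" for x B
    using card[OF assms(1), of "{i. (i, k (snd x)) \<in> B}"] by (cases x) (simp add: row_eq)
  have col: "col x (map_prod h k -` B) = col (map_prod h k x) B" for x B
    using card[OF assms(2), of "{j. (h (fst x), j) \<in> B}"] by (cases x) (simp add: col_eq)
  have "step Z (map_prod h k -` B) = map_prod h k -` step Z B" for B
    unfolding step_def row col by auto
  then show ?thesis by (induction t) auto
qed

lemma
  assumes "bij h" "bij k"
  shows spans_vimage: "spans Z (map_prod h k -` A) \<longleftrightarrow> spans Z A"
    and span_time_vimage: "span_time Z (map_prod h k -` A) = span_time Z A"
proof -
  have surj: "surj (map_prod h k)" using assms by (simp add: bij_is_surj map_prod_surj)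
  have UNIV: "map_prod h k -` B = UNIV \<longleftrightarrow> B = UNIV" for B
    using surj_image_vimage_eq[OF surj, of B] surj by (metis vimage_UNIV)
  show "spans Z (map_prod h k -` A) \<longleftrightarrow> spans Z A"
    unfolding spans_def funpow_step_vimage[OF assms] vimage_UN[symmetric] UNIV ..
  show "span_time Z (map_prod h k -` A) = span_time Z A"
    unfolding span_time_def funpow_step_vimage[OF assms] UNIV ..
qed

text \<open>List \<open>F\<close> in the order of \<open>p\<close>, then enumerate its infinite
  complement.\<close>

lemma ex_sorting_bij:
  fixes F :: "nat set" and p :: "nat \<Rightarrow> 'a :: linorder"
  assumes "finite F"
  obtains h :: "nat \<Rightarrow> nat" where "bij h"
    "\<And>i i'. i \<le> i' \<Longrightarrow> h i' \<in> F \<Longrightarrow> h i \<in> F \<and> p (h i) \<le> p (h i')"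
proof -
  define xs where "xs = sort_key p (sorted_list_of_set F)"
  define n where "n = length xs"
  have xs: "set xs = F" "distinct xs" "sorted (map p xs)"
    using assms by (simp_all add: xs_def)
  have nth: "bij_betw ((!) xs) {..<n} F"
    using bij_betw_nth[OF xs(2)] xs(1) by (simp add: n_def)
  have "bij_betw (\<lambda>i. i - n) {n..} UNIV"
    by (rule bij_betw_byWitness[where f' = "\<lambda>i. i + n"]) auto
  then have enum: "bij_betw (enumerate (- F) \<circ> (\<lambda>i. i - n)) {n..} (- F)"
    using assms by (intro bij_betw_trans[OF _ bij_enumerate]) simp_all
  define h where "h i = (if i \<in> {..<n} then xs ! i else (enumerate (- F) \<circ> (\<lambda>i. i - n)) i)" for i
  have "bij_betw h ({..<n} \<union> {n..}) (F \<union> - F)"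
    unfolding h_def by (rule bij_betw_disjoint_Un[OF nth enum]) auto
  moreover have "{..<n} \<union> {n..} = UNIV" by auto
  ultimately have "bij h" by simp
  have h_in: "h i \<in> F \<longleftrightarrow> i < n" for i
    using bij_betwE[OF nth] bij_betwE[OF enum] by (auto simp: h_def)
  have sorted: "h i \<in> F \<and> p (h i) \<le> p (h i')" if "i \<le> i'" "h i' \<in> F" for i i'
    using that sorted_nth_mono[OF xs(3), of i i'] unfolding h_in by (auto simp: h_def n_def)
  show ?thesis by (rule that[OF \<open>bij h\<close> sorted])
qed


subsection \<open>Thin sets\<close>

text \<open>The relation \<open>M\<close> is abstract so that the lemma serves rows and, transposed,
  columns. As keys are opposite at each point, a line with strictly smaller key has its points after
  those of the other line; once the other tail is nonempty, its own tail is the whole line. Lines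
  with equal keys carry the same points.\<close>

lemma sorted_tail_card_mono:
  fixes M :: "nat \<Rightarrow> nat \<Rightarrow> bool" and p q :: "nat \<Rightarrow> int"
  assumes h: "bij h" "\<And>i i' b. i \<le> i' \<Longrightarrow> M (h i') b \<Longrightarrow> p (h i) \<le> p (h i')"
    and k: "\<And>j j' a. j \<le> j' \<Longrightarrow> M a (k j') \<Longrightarrow> q (k j) \<le> q (k j') \<and> (\<exists>a. M a (k j))"
    and fin: "\<And>b. finite {a. M a b}"
    and anti: "\<And>a b. M a b \<Longrightarrow> q b = - p a"
    and card: "\<And>a b a' b'. M a b \<Longrightarrow> M a' b' \<Longrightarrow> q b \<le> q b' \<Longrightarrow>
      card {a. M a b'} \<le> card {a. M a b}"
    and tie: "\<And>a b a' b'. M a b \<Longrightarrow> M a' b' \<Longrightarrow> q b = q b' \<Longrightarrow> {a. M a b'} = {a. M a b}"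
    and "j \<le> j'"
  shows "card {i. M (h i) (k j') \<and> m \<le> enat i} \<le> card {i. M (h i) (k j) \<and> m \<le> enat i}"
proof (cases "\<exists>i'. M (h i') (k j') \<and> m \<le> enat i'")
  case True
  then obtain i' where i': "M (h i') (k j')" "m \<le> enat i'" by blast
  obtain a where a: "M a (k j)" and le: "q (k j) \<le> q (k j')"
    using k[OF \<open>j \<le> j'\<close> i'(1)] by blast
  have vimage_card: "card {i. M (h i) b} = card {a. M a b}" for b
  proof -
    have "h ` {i. M (h i) b} = {a. M a b}"
      using bij_is_surj[OF h(1)] by (auto simp: image_iff)
    then show ?thesis
      by (metis bij_is_inj[OF h(1)] card_image inj_on_subset subset_UNIV)
  qed
  have vimage_fin: "finite {i. M (h i) b}" for b
    using finite_vimageI[OF fin bij_is_inj[OF h(1)]] by (simp add: vimage_def)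
  show ?thesis
  proof (cases "q (k j) = q (k j')")
    case True
    then have "M x (k j') \<longleftrightarrow> M x (k j)" for x using tie[OF a i'(1)] by blast
    then show ?thesis by simp
  next
    case False
    have "m \<le> enat i" if "M (h i) (k j)" for i
    proof -
      have "p (h i') < p (h i)"
        using False le anti[OF that] anti[OF i'(1)] by simp
      then have "i' \<le> i" using h(2)[OF _ i'(1), of i] by force
      then show ?thesis using i'(2) by (meson enat_ord_simps(1) order_trans)
    qed
    then have tail: "{i. M (h i) (k j) \<and> m \<le> enat i} = {i. M (h i) (k j)}" by blast
    have "card {i. M (h i) (k j') \<and> m \<le> enat i} \<le> card {i. M (h i) (k j')}"
      by (rule card_mono[OF vimage_fin]) auto
    also have "\<dots> \<le> card {i. M (h i) (k j)}"
      unfolding vimage_card by (rule card[OF a i'(1) le])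
    finally show ?thesis unfolding tail .
  qed
next
  case False
  then have "{i. M (h i) (k j') \<and> m \<le> enat i} = {}" by blast
  then show ?thesis by (simp only: card.empty le0)
qed

text \<open>The key of a point is its row count minus its column count.  Ties are broken by the line
  that contains more points; for a thin set this makes the key constant along every line and
  lets only collinear points share a key.\<close>

lemma thin_sorting_keys:
  assumes "thin A"
  obtains p q :: "nat \<Rightarrow> int" where
    "\<And>a b. (a, b) \<in> A \<Longrightarrow> q b = - p a"
    "\<And>a b a' b'. (a, b) \<in> A \<Longrightarrow> (a', b') \<in> A \<Longrightarrow> q b \<le> q b' \<Longrightarrow>
      card {a. (a, b') \<in> A} \<le> card {a. (a, b) \<in> A}"
    "\<And>a b a' b'. (a, b) \<in> A \<Longrightarrow> (a', b') \<in> A \<Longrightarrow> q b = q b' \<Longrightarrow>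
      {a. (a, b') \<in> A} = {a. (a, b) \<in> A}"
    "\<And>a b a' b'. (a, b) \<in> A \<Longrightarrow> (a', b') \<in> A \<Longrightarrow> p a \<le> p a' \<Longrightarrow>
      card {b. (a', b) \<in> A} \<le> card {b. (a, b) \<in> A}"
    "\<And>a b a' b'. (a, b) \<in> A \<Longrightarrow> (a', b') \<in> A \<Longrightarrow> p a = p a' \<Longrightarrow>
      {b. (a', b) \<in> A} = {b. (a, b) \<in> A}"
proof -
  have fin: "finite A" using assms by (simp add: thin_def)
  define R where "R b = card {a. (a, b) \<in> A}" for b
  define C where "C a = card {b. (a, b) \<in> A}" for a
  have fin_row: "finite {a. (a, b) \<in> A}" for b
    by (rule finite_subset[OF _ finite_imageI[OF fin, of fst]]) force
  have fin_col: "finite {b. (a, b) \<in> A}" for a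
    by (rule finite_subset[OF _ finite_imageI[OF fin, of snd]]) force
  have pos: "R b > 0" "C a > 0" if "(a, b) \<in> A" for a b
    using that fin_row fin_col by (auto simp: R_def C_def card_gt_0_iff)
  have thin: "R b = 1 \<or> C a = 1" if "(a, b) \<in> A" for a b
    using assms that fin_row fin_col
    by (force simp: thin_def row_eq col_eq ecard_def R_def C_def one_enat_def)
  have single_row: "a = a'" if "(a, b) \<in> A" "(a', b) \<in> A" "R b = 1" for a a' b
    using that unfolding R_def by (auto simp: card_1_singleton_iff set_eq_iff)
  have single_col: "b = b'" if "(a, b) \<in> A" "(a, b') \<in> A" "C a = 1" for a b b'
    using that unfolding C_def by (auto simp: card_1_singleton_iff set_eq_iff)
  obtain N where N: "\<forall>n \<in> fst ` A \<union> snd ` A. n < N"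
    using fin finite_nat_set_iff_bounded by (metis finite_UnI finite_imageI)
  define d where "d a b = int (R b) - int (C a)" for a b
  \<comment> \<open>On a thin set \<open>d <= 0\<close> forces \<open>R b = 1\<close> and
    \<open>d > 0\<close> forces \<open>C a = 1\<close>, so \<open>e\<close> is the index of a
    longest line through the point. As \<open>e < N\<close> on \<open>A\<close>, the integer
    \<open>P\<close> encodes \<open>(d, e)\<close> lexicographically.\<close>
  define e where "e a b = (if d a b \<le> 0 then a else b)" for a b
  define P where "P a b = d a b * int N + int (e a b)" for a b
  have e_less: "e a b < N" if "(a, b) \<in> A" for a b
    using N that by (force simp: e_def)
  have P_div: "P a b div int N = d a b" and P_mod: "P a b mod int N = int (e a b)"
    if "(a, b) \<in> A" for a b
    using e_less[OF that] by (simp_all add: P_def)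
  have d_mono: "d a b \<le> d a' b'" if "(a, b) \<in> A" "(a', b') \<in> A" "P a b \<le> P a' b'" for a b a' b'
    using zdiv_mono1[OF that(3), of "int N"] e_less[OF that(1)] that by (simp add: P_div)
  have P_eq: "d a b = d a' b'" "e a b = e a' b'"
    if "(a, b) \<in> A" "(a', b') \<in> A" "P a b = P a' b'" for a b a' b'
    using that P_div[OF that(1)] P_div[OF that(2)] P_mod[OF that(1)] P_mod[OF that(2)] by simp_all
  \<comment> \<open>In a column with several points all row counts are 1, so
    \<open>d = 1 - C a <= 0\<close> and \<open>e = a\<close> throughout.\<close>
  have P_col: "P a b = P a b'" if "(a, b) \<in> A" "(a, b') \<in> A" for a b b'
  proof (cases "C a = 1")
    case False
    then have "R b = 1" "R b' = 1" using thin that by blast+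
    moreover have "C a > 0" using pos that by blast
    ultimately show ?thesis by (simp add: P_def d_def e_def)
  qed (use single_col that in blast)
  have P_row: "P a b = P a' b" if "(a, b) \<in> A" "(a', b) \<in> A" for a a' b
  proof (cases "R b = 1")
    case False
    then have "C a = 1" "C a' = 1" using thin that by blast+
    moreover have "R b > 1" using pos that False by fastforce
    ultimately show ?thesis by (simp add: P_def d_def e_def)
  qed (use single_row that in blast)
  \<comment> \<open>By \<open>P_col\<close> and \<open>P_row\<close> the choice of the point is
    immaterial; lines that miss \<open>A\<close> get arbitrary keys.\<close>
  define p where "p a = P a (SOME b. (a, b) \<in> A)" for a
  define q where "q b = - P (SOME a. (a, b) \<in> A) b" for b
  have p: "p a = P a b" if "(a, b) \<in> A" for a b
    unfolding p_def by (rule P_col[OF someI that]) (rule that)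
  have q: "q b = - P a b" if "(a, b) \<in> A" for a b
    unfolding q_def using P_row[OF someI[of "\<lambda>a. (a, b) \<in> A", OF that] that] by simp
  show ?thesis
  proof
    fix a b a' b' assume A: "(a, b) \<in> A" and A': "(a', b') \<in> A"
    show "q b = - p a" using p[OF A] q[OF A] by simp
    show "card {a. (a, b') \<in> A} \<le> card {a. (a, b) \<in> A}" if "q b \<le> q b'"
    proof -
      have "d a' b' \<le> d a b" using that d_mono[OF A' A] q[OF A] q[OF A'] by simp
      \<comment> \<open>Either \<open>R b' = 1\<close>, or \<open>C a' = 1\<close> and then
        \<open>R b' - 1 <= R b - C a <= R b - 1\<close>.\<close>
      then have "R b' \<le> R b"
        using pos[OF A] pos[OF A'] thin[OF A'] by (auto simp: d_def)
      then show ?thesis by (simp add: R_def)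
    qed
    show "card {b. (a', b) \<in> A} \<le> card {b. (a, b) \<in> A}" if "p a \<le> p a'"
    proof -
      have "d a b \<le> d a' b'" using that d_mono[OF A A'] p[OF A] p[OF A'] by simp
      then have "C a' \<le> C a"
        using pos[OF A] pos[OF A'] thin[OF A'] by (auto simp: d_def)
      then show ?thesis by (simp add: C_def)
    qed
    show "{a. (a, b') \<in> A} = {a. (a, b) \<in> A}" if "q b = q b'"
    proof -
      have eq: "d a b = d a' b'" "e a b = e a' b'"
        using that P_eq[OF A A'] q[OF A] q[OF A'] by simp_all
      show ?thesis
      proof (cases "d a b \<le> 0")
        case True
        then have "R b = 1" "R b' = 1" "a = a'"
          using eq thin[OF A] thin[OF A'] pos[OF A] pos[OF A'] by (auto simp: d_def e_def)
        then show ?thesis using single_row A A' by blast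
      qed (use eq in \<open>simp add: e_def\<close>)
    qed
    show "{b. (a', b) \<in> A} = {b. (a, b) \<in> A}" if "p a = p a'"
    proof -
      have eq: "d a b = d a' b'" "e a b = e a' b'"
        using that P_eq[OF A A'] p[OF A] p[OF A'] by simp_all
      show ?thesis
      proof (cases "d a b \<le> 0")
        case False
        then have "C a = 1" "C a' = 1" "b = b'"
          using eq thin[OF A] thin[OF A'] pos[OF A] pos[OF A'] by (auto simp: d_def e_def)
        then show ?thesis using single_col A A' by blast
      qed (use eq in \<open>simp add: e_def\<close>)
    qed
  qed
qed

text \<open>Columns are sorted by \<open>p\<close> and rows by \<open>q\<close>; the tail condition
  for columns follows from that for rows with the keys exchanged. The resulting bound is half of
  \<open>8 * side Z + 2\<close>.\<close>

lemma span_time_thin_le: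
  assumes Z: "zero_set Z" and A: "thin A" "spans Z A"
  shows "span_time Z A \<le> enat (4 * side Z + 1)"
proof -
  have fin: "finite A" using A(1) by (simp add: thin_def)
  have fin_row: "finite {a. (a, b) \<in> A}" for b
    by (rule finite_subset[OF _ finite_imageI[OF fin, of fst]]) force
  have fin_col: "finite {b. (a, b) \<in> A}" for a
    by (rule finite_subset[OF _ finite_imageI[OF fin, of snd]]) force
  obtain p q :: "nat \<Rightarrow> int" where
    anti: "\<And>a b. (a, b) \<in> A \<Longrightarrow> q b = - p a" and
    q_card: "\<And>a b a' b'. (a, b) \<in> A \<Longrightarrow> (a', b') \<in> A \<Longrightarrow> q b \<le> q b' \<Longrightarrow>
      card {a. (a, b') \<in> A} \<le> card {a. (a, b) \<in> A}" and
    q_tie: "\<And>a b a' b'. (a, b) \<in> A \<Longrightarrow> (a', b') \<in> A \<Longrightarrow> q b = q b' \<Longrightarrow>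
      {a. (a, b') \<in> A} = {a. (a, b) \<in> A}" and
    p_card: "\<And>a b a' b'. (a, b) \<in> A \<Longrightarrow> (a', b') \<in> A \<Longrightarrow> p a \<le> p a' \<Longrightarrow>
      card {b. (a', b) \<in> A} \<le> card {b. (a, b) \<in> A}" and
    p_tie: "\<And>a b a' b'. (a, b) \<in> A \<Longrightarrow> (a', b') \<in> A \<Longrightarrow> p a = p a' \<Longrightarrow>
      {b. (a', b) \<in> A} = {b. (a, b) \<in> A}"
    by (rule thin_sorting_keys[OF A(1)]) (rule that, assumption+)
  obtain h :: "nat \<Rightarrow> nat" where h: "bij h"
    "\<And>i i'. i \<le> i' \<Longrightarrow> h i' \<in> fst ` A \<Longrightarrow> h i \<in> fst ` A \<and> p (h i) \<le> p (h i')"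
    by (rule ex_sorting_bij[OF finite_imageI[OF fin, of fst], where p = p]) (rule that, assumption+)
  obtain k :: "nat \<Rightarrow> nat" where k: "bij k"
    "\<And>j j'. j \<le> j' \<Longrightarrow> k j' \<in> snd ` A \<Longrightarrow> k j \<in> snd ` A \<and> q (k j) \<le> q (k j')"
    by (rule ex_sorting_bij[OF finite_imageI[OF fin, of snd], where p = q]) (rule that, assumption+)
  have h': "p (h i) \<le> p (h i') \<and> (\<exists>b. (h i, b) \<in> A)" if "i \<le> i'" "(h i', b) \<in> A" for i i' b
    using h(2)[OF that(1)] that(2) by force
  have k': "q (k j) \<le> q (k j') \<and> (\<exists>a. (a, k j) \<in> A)" if "j \<le> j'" "(a, k j') \<in> A" for j j' a
    using k(2)[OF that(1)] that(2) by force
  have anti': "p a = - q b" if "(a, b) \<in> A" for a b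
    using anti[OF that] by simp
  let ?A = "map_prod h k -` A"
  have "span_time Z ?A \<le> enat (4 * side Z + 1)"
  proof (rule span_time_sorted_le[OF Z])
    show "finite ?A"
      using fin h(1) k(1) by (intro finite_vimageI) (simp_all add: bij_is_inj prod.inj_map)
    show "spans Z ?A" using A(2) spans_vimage[OF h(1) k(1)] by blast
    fix x y :: nat and m :: enat assume le: "x \<le> y"
    have "card {i. (h i, k y) \<in> A \<and> m \<le> enat i} \<le> card {i. (h i, k x) \<in> A \<and> m \<le> enat i}"
      by (rule sorted_tail_card_mono[where p = p and q = q and M = "\<lambda>a b. (a, b) \<in> A"])
        (fact h(1) h'[THEN conjunct1] k' fin_row anti q_card q_tie le)+
    then show "card {i. (i, y) \<in> ?A \<and> m \<le> enat i} \<le> card {i. (i, x) \<in> ?A \<and> m \<le> enat i}"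
      by simp
    have "card {j. (h y, k j) \<in> A \<and> m \<le> enat j} \<le> card {j. (h x, k j) \<in> A \<and> m \<le> enat j}"
      by (rule sorted_tail_card_mono[where p = q and q = p and M = "\<lambda>b a. (a, b) \<in> A"])
        (fact k(1) k'[THEN conjunct1] h' fin_col anti' p_card p_tie le)+
    then show "card {j. (y, j) \<in> ?A \<and> m \<le> enat j} \<le> card {j. (x, j) \<in> ?A \<and> m \<le> enat j}"
      by simp
  qed
  then show ?thesis unfolding span_time_vimage[OF h(1) k(1)] .
qed


subsection \<open>Suprema\<close>

lemma mu_en_le:
  assumes "zero_set Z"
  shows "mu_en Z \<le> enat (4 * side Z + 1)"
  unfolding mu_en_def by (rule SUP_least) (use span_time_en_le[OF assms] in auto)

lemma mu_th_le:
  assumes "zero_set Z"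
  shows "mu_th Z \<le> enat (4 * side Z + 1)"
  unfolding mu_th_def by (rule SUP_least) (use span_time_thin_le[OF assms] in auto)

lemma Inf_enat_ge_1: "1 \<le> Inf (enat ` {t. 1 \<le> t \<and> P t})"
  by (rule Inf_greatest) (auto simp: one_enat_def)

lemma mu_en_ge_1:
  assumes "zero_set Z"
  shows "1 \<le> mu_en Z"
proof -
  obtain r c where "admissible Z r c" using ex_admissible[OF assms] by blast
  then have "span_time_en Z r c \<le> mu_en Z"
    unfolding mu_en_def by (intro SUP_upper2[of "(r, c)"]) auto
  moreover have "1 \<le> span_time_en Z r c" unfolding span_time_en_def by (rule Inf_enat_ge_1)
  ultimately show ?thesis by (rule order_trans[rotated])
qed

lemma mu_th_ge_1:
  assumes "zero_set Z"
  shows "1 \<le> mu_th Z"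
proof -
  obtain A where "thin A" "spans Z A" using ex_thin_spans[OF assms] by blast
  then have "span_time Z A \<le> mu_th Z"
    unfolding mu_th_def by (intro SUP_upper) auto
  moreover have "1 \<le> span_time Z A" unfolding span_time_def by (rule Inf_enat_ge_1)
  ultimately show ?thesis by (rule order_trans[rotated])
qed

text \<open>A nonempty zero-set has \<open>side Z >= 1\<close>, so each ratio is at most
  \<open>(4 * s + 1) / s <= 5\<close>; the zero-set \<open>rect 1 1\<close> contributes a positive
  one.\<close>

lemma SUP_ratio_pos_finite:
  assumes upper: "\<And>Z. zero_set Z \<Longrightarrow> mu Z \<le> enat (4 * side Z + 1)"
    and lower: "\<And>Z. zero_set Z \<Longrightarrow> 1 \<le> mu Z"
  shows "(SUP Z\<in>{Z. zero_set Z \<and> Z \<noteq> {}}. ereal_of_enat (mu Z) / ereal (real (side Z)))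
    \<in> {0<..<\<infinity>}"
proof -
  let ?S = "SUP Z\<in>{Z. zero_set Z \<and> Z \<noteq> {}}. ereal_of_enat (mu Z) / ereal (real (side Z))"
  have ratio: "0 < ereal_of_enat (mu Z) / ereal (real (side Z)) \<and>
      ereal_of_enat (mu Z) / ereal (real (side Z)) \<le> ereal 5"
    if Z: "zero_set Z" "Z \<noteq> {}" for Z
  proof -
    obtain n where n: "mu Z = enat n" "n \<le> 4 * side Z + 1"
      using upper[OF Z(1)] by (cases "mu Z") auto
    moreover have "n > 0" using lower[OF Z(1)] n(1) by (simp add: one_enat_def)
    ultimately show ?thesis using side_pos[OF Z] by (simp add: divide_simps)
  qed
  have "zero_set (rect 1 1)"
    unfolding zero_set_def by (rule exI[of _ "{(1, 1)}"]) simp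
  moreover have "rect 1 1 \<noteq> {}" by (auto simp: rect_def)
  ultimately have "0 < ?S"
    using ratio by (intro less_SUP_iff[THEN iffD2]) blast
  moreover have "?S \<le> ereal 5" by (rule SUP_least) (use ratio in blast)
  ultimately show ?thesis by (auto intro: le_less_trans)
qed

theorem theorem1p3:
  shows "(\<forall>Z. zero_set Z \<longrightarrow>
            mu_en Z \<le> enat (4 * side Z + 1) \<and> mu_th Z \<le> enat (8 * side Z + 2))
    \<and> (SUP Z\<in>{Z. zero_set Z \<and> Z \<noteq> {}}. ereal_of_enat (mu_en Z) / ereal (real (side Z))) \<in> {0<..<\<infinity>}
    \<and> (SUP Z\<in>{Z. zero_set Z \<and> Z \<noteq> {}}. ereal_of_enat (mu_th Z) / ereal (real (side Z))) \<in> {0<..<\<infinity>}"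
proof (intro conjI allI impI)
  fix Z assume Z: "zero_set Z"
  show "mu_en Z \<le> enat (4 * side Z + 1)" by (rule mu_en_le[OF Z])
  have "mu_th Z \<le> enat (4 * side Z + 1)" by (rule mu_th_le[OF Z])
  also have "\<dots> \<le> enat (8 * side Z + 2)" by simp
  finally show "mu_th Z \<le> enat (8 * side Z + 2)" .
qed (intro SUP_ratio_pos_finite mu_en_le mu_en_ge_1 mu_th_le mu_th_ge_1; assumption)+

end
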